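(* Let $N_j$ and $M_j$ ($j\ge1$) be positive integers satisfying $$N_j=M_jK_j+\alpha_j$$ for some integer $K_j$ and $0\le\alpha_j<M_j$ with $$\sum_{j=1}^{\infty}\frac{\alpha_j\sqrt{M_j}}{K_j}<\infty .$$ Define $$B_j=\{0,K_j,\ldots,(M_j-1)K_j\},\qquad L_j=\{0,1,\ldots,M_j-1\}.$$ Then $\{(N_j,B_j)\}_{j\ge1}$ forms an almost-Parseval-frame tower associated with $$\epsilon_j=\frac{2\pi\alpha_j\sqrt{M_j}}{K_j},$$ and its pre-spectrum is $\{L_j\}_{j\ge1}$.
   Context: Definition of an almost-Parseval-frame tower: let $\epsilon_j$ ($j\ge1$) be such that $0\le\epsilon_j<1$ and $\sum_{j=1}^\infty\epsilon_j<\infty$. A sequence $\{(N_j,B_j)\}_{j\ge1}$ is an almost-Parseval-frame tower associated with $\{\epsilon_j\}$ if: (1) each $N_j$ is an integer with $N_j\ge2$; (2) $B_j\subset\{0,1,\ldots,N_j-1\}$ and $0\in B_j$ for all $j$; (3) with $M_j:=\#B_j$, for every $j$ there is $L_j\subset\mathbb Z$ with $0\in L_j$ such that $$(1-\epsilon_j)^2\sum_{b\in B_j}|w_b|^2\le\sum_{\lambda\in L_j}\Big|\frac1{\sqrt{M_j}}\sum_{b\in B_j}w_be^{-2\pi i b\lambda/N_j}\Big|^2\le(1+\epsilon_j)^2\sum_{b\in B_j}|w_b|^2$$ for all $(w_b)_{b\in B_j}\in\mathbb C^{M_j}$. A sequence $\{L_j\}$ as in (3) is called a pre-spectrum for the 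tower.
   Formalization: The formal statement additionally assumes N_j ≥ 2, K_j ≠ 0 and ε_j < 1 for all j; without them the claim fails (N=M=K=1, α=0 violates N_j ≥ 2; N=3, M=2, K=1, α=1 gives ε_j > 1) or the quotient by K_j is undefined. *)

theory Defs
  imports "HOL-Analysis.Analysis"
begin

text \<open>Sequences indexed by \<open>j \<ge> 1\<close> are functions on \<^typ>\<open>nat\<close> whose value at \<open>0\<close> is irrelevant.
  Families \<open>(w\<^sub>b)\<^sub>b\<^sub>\<in>\<^sub>B\<close> are functions on \<^typ>\<open>int\<close> of which only the values on \<open>B\<close> matter.\<close>

definition frame_term :: "int \<Rightarrow> int set \<Rightarrow> (int \<Rightarrow> complex) \<Rightarrow> int \<Rightarrow> real" where
  "frame_term N B w l =
     (cmod (1 / of_real (sqrt (real (card B))) *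
        (\<Sum>b\<in>B. w b * exp (- (2 * of_real pi * \<i> * of_int b * of_int l / of_int N)))))\<^sup>2"

text \<open>The set \<open>L\<close> is not required to be finite, so the middle sum is an unordered infinite sum.
  As \<^const>\<open>infsum\<close> is \<open>0\<close> on non-summable families, summability is
  a separate conjunct: it is what a finite upper bound means for a sum of nonnegative terms.\<close>

definition almost_parseval_frame_ineq :: "real \<Rightarrow> int \<Rightarrow> int set \<Rightarrow> int set \<Rightarrow> bool" where
  "almost_parseval_frame_ineq e N B L \<longleftrightarrow>
     (\<forall>w :: int \<Rightarrow> complex.
        frame_term N B w summable_on L \<and>
        (1 - e)\<^sup>2 * (\<Sum>b\<in>B. (cmod (w b))\<^sup>2) \<le> (\<Sum>\<^sub>\<infinity>l\<in>L. frame_term N B w l) \<and>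
        (\<Sum>\<^sub>\<infinity>l\<in>L. frame_term N B w l) \<le> (1 + e)\<^sup>2 * (\<Sum>b\<in>B. (cmod (w b))\<^sup>2))"

definition almost_parseval_frame_tower ::
  "(nat \<Rightarrow> real) \<Rightarrow> (nat \<Rightarrow> int) \<Rightarrow> (nat \<Rightarrow> int set) \<Rightarrow> bool" where
  "almost_parseval_frame_tower \<epsilon> N B \<longleftrightarrow>
     (\<forall>j\<ge>1. 0 \<le> \<epsilon> j \<and> \<epsilon> j < 1) \<and> summable (\<lambda>j. \<epsilon> (Suc j)) \<and>
     (\<forall>j\<ge>1. N j \<ge> 2) \<and>
     (\<forall>j\<ge>1. B j \<subseteq> {0..N j - 1} \<and> 0 \<in> B j) \<and>
     (\<forall>j\<ge>1. \<exists>L. 0 \<in> L \<and> almost_parseval_frame_ineq (\<epsilon> j) (N j) (B j) L)"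

definition is_pre_spectrum ::
  "(nat \<Rightarrow> real) \<Rightarrow> (nat \<Rightarrow> int) \<Rightarrow> (nat \<Rightarrow> int set) \<Rightarrow> (nat \<Rightarrow> int set) \<Rightarrow> bool" where
  "is_pre_spectrum \<epsilon> N B L \<longleftrightarrow>
     (\<forall>j\<ge>1. 0 \<in> L j \<and> almost_parseval_frame_ineq (\<epsilon> j) (N j) (B j) (L j))"

end

theory Submission
  imports Defs
begin

text \<open>After the reindexing \<open>b = m K\<close> the analysis operator of \<open>(N, B, L)\<close> has the matrix
  \<open>exp (- 2 \<pi> i m K l / N) / \<surd>M\<close>, and replacing \<open>K / N\<close> by \<open>1 / M\<close> turns it into
  the unitary discrete Fourier transform of order \<open>M\<close>.  As \<open>\<bar>K / N - 1 / M\<bar> = \<alpha> / (M N)\<close> and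
  \<open>m, l < M\<close>, every phase moves by at most \<open>2 \<pi> \<alpha> M / N \<le> 2 \<pi> \<alpha> / K\<close>, so by Cauchy--Schwarz
  the operator differs from the unitary one by at most \<open>2 \<pi> \<alpha> \<surd>M / K = \<epsilon>\<close> in norm.\<close>

text \<open>A chord is no longer than its arc. This turns an error in a phase into an error in a
  matrix entry.\<close>

lemma norm_cis_diff_le: "cmod (cis s - cis t) \<le> \<bar>s - t\<bar>"
proof -
  have "cis s - cis t = cis t * (cis (s - t) - 1)"
    by (simp add: right_diff_distrib cis_mult)
  then have "cmod (cis s - cis t) = cmod (exp (\<i> * of_real (s - t)) - 1)"
    by (simp only: norm_mult norm_cis mult_1 cis_conv_exp[of "s - t"])
  also have "\<dots> = 2 * \<bar>sin ((s - t) / 2)\<bar>"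
    by (rule dist_exp_i_1)
  also have "\<dots> \<le> \<bar>s - t\<bar>"
    using abs_sin_x_le_abs_x[of "(s - t) / 2"] by simp
  finally show ?thesis .
qed

text \<open>The factor \<open>1 / sqrt M\<close> is left out, so that the product of one character
  with the conjugate of another is again a character.\<close>

definition dft_char :: "int \<Rightarrow> int \<Rightarrow> int \<Rightarrow> complex" where
  "dft_char M m l = cis (- (2 * pi * of_int m * of_int l / of_int M))"

text \<open>A geometric sum whose ratio is an \<open>M\<close>-th root of unity, equal to 1 only for
  \<open>k = 0\<close>. The range of \<open>k\<close> covers every difference of two indices in
  \<open>{0..M - 1}\<close>.\<close>

lemma sum_dft_char:
  assumes M: "M > 0" and k: "\<bar>k\<bar> < M"
  shows "(\<Sum>l\<in>{0..M - 1}. dft_char M k l) = (if k = 0 then of_int M else 0)"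
proof (cases "k = 0")
  case True
  then show ?thesis using M by (simp add: dft_char_def)
next
  case False
  define z where "z = dft_char M k 1"
  have z_pow: "dft_char M k (int n) = z ^ n" for n
    by (simp add: z_def dft_char_def Complex.DeMoivre mult_ac)
  have "z \<noteq> 1"
  proof
    assume "z = 1"
    then obtain n :: int where "- (2 * pi * of_int k / of_int M) = of_int (2 * n) * pi"
      unfolding z_def dft_char_def cis_conv_exp exp_eq_1 by auto
    then have "pi * real_of_int (- k) = pi * of_int (n * M)"
      using M by (simp add: field_simps)
    then have "real_of_int (- k) = of_int (n * M)"
      by (simp only: mult_cancel_left pi_neq_zero simp_thms)
    then have "- k = n * M" by (simp only: of_int_eq_iff)
    \<comment> \<open>\<open>M\<close> would divide \<open>k\<close>, although
      \<open>0 < \<bar>k\<bar> < M\<close>.\<close>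
    then show False
      using k False M zdvd_imp_le[of M "\<bar>k\<bar>"]
      by (metis abs_dvd_iff dvd_abs_iff dvd_minus_iff dvd_triv_right not_le zero_less_abs_iff)
  qed
  moreover have "z ^ nat M = 1"
  proof -
    have "z ^ nat M = dft_char M k M" using z_pow[of "nat M"] M by simp
    also have "\<dots> = cis (2 * pi * of_int (- k))"
      using M by (simp add: dft_char_def)
    also have "\<dots> = 1"
      by (rule cis_multiple_2pi) simp
    finally show ?thesis .
  qed
  moreover have "(\<Sum>l\<in>{0..M - 1}. dft_char M k l) = (\<Sum>n<nat M. z ^ n)"
    using M by (intro sum.reindex_bij_witness[of _ int nat]) (auto simp flip: z_pow)
  ultimately show ?thesis using False by (simp add: geometric_sum)
qed

text \<open>Expand the squared modulus into a double sum and sum over \<open>l\<close> first: by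
  orthogonality of the characters only the diagonal \<open>m = n\<close> survives.\<close>

lemma dft_Parseval:
  assumes M: "M > 0"
  shows "(\<Sum>l\<in>{0..M - 1}. (cmod (\<Sum>m\<in>{0..M - 1}. x m * dft_char M m l))\<^sup>2)
       = of_int M * (\<Sum>m\<in>{0..M - 1}. (cmod (x m))\<^sup>2)" (is "?l = ?r")
proof -
  let ?I = "{0..M - 1}"
  have conj: "dft_char M m l * cnj (dft_char M n l) = dft_char M (m - n) l" for m n l
    by (simp add: dft_char_def cis_cnj cis_mult left_diff_distrib right_diff_distrib diff_divide_distrib)
  have "complex_of_real ?l
      = (\<Sum>l\<in>?I. (\<Sum>m\<in>?I. x m * dft_char M m l) * cnj (\<Sum>n\<in>?I. x n * dft_char M n l))"
    by (simp only: of_real_sum complex_norm_square)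
  also have "\<dots> = (\<Sum>l\<in>?I. \<Sum>m\<in>?I. \<Sum>n\<in>?I. x m * cnj (x n) * dft_char M (m - n) l)"
    by (simp add: sum_product mult_ac flip: conj)
  also have "\<dots> = (\<Sum>m\<in>?I. \<Sum>l\<in>?I. \<Sum>n\<in>?I. x m * cnj (x n) * dft_char M (m - n) l)"
    by (rule sum.swap)
  also have "\<dots> = (\<Sum>m\<in>?I. \<Sum>n\<in>?I. \<Sum>l\<in>?I. x m * cnj (x n) * dft_char M (m - n) l)"
    by (intro sum.cong refl sum.swap)
  also have "\<dots> = (\<Sum>m\<in>?I. \<Sum>n\<in>?I. x m * cnj (x n) * (if m = n then of_int M else 0))"
    unfolding sum_distrib_left[symmetric]
    by (intro sum.cong refl, subst sum_dft_char) (use M in auto)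
  also have "\<dots> = (\<Sum>m\<in>?I. x m * cnj (x m) * of_int M)"
    by (intro sum.cong refl) (simp add: if_distrib sum.delta' cong: if_cong)
  also have "\<dots> = complex_of_real ?r"
    by (simp only: of_real_mult of_real_of_int_eq of_real_sum complex_norm_square sum_distrib_left mult_ac)
  finally show ?thesis by (simp only: of_real_eq_iff)
qed

text \<open>The reverse triangle inequality, which yields the upper and the lower frame bound at
  once.\<close>

lemma L2_set_abs_diff_le: "\<bar>L2_set f A - L2_set g A\<bar> \<le> L2_set (\<lambda>i. f i - g i) A"
proof -
  have "L2_set f A \<le> L2_set g A + L2_set (\<lambda>i. f i - g i) A"
    using L2_set_triangle_ineq[of g "\<lambda>i. f i - g i" A] by simp
  moreover have "L2_set g A \<le> L2_set f A + L2_set (\<lambda>i. g i - f i) A"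
    using L2_set_triangle_ineq[of f "\<lambda>i. g i - f i" A] by simp
  moreover have "L2_set (\<lambda>i. g i - f i) A = L2_set (\<lambda>i. f i - g i) A"
    by (simp add: L2_set_def power2_commute)
  ultimately show ?thesis by linarith
qed

lemma frame_term_arith_progression:
  assumes M: "M > 0" and K: "K > 0"
  shows "frame_term N ((\<lambda>m. m * K) ` {0..M - 1}) w l
    = (cmod (\<Sum>m\<in>{0..M - 1}. w (m * K) * cis (- (2 * pi * of_int m * of_int K * of_int l / of_int N)))
        / sqrt (of_int M))\<^sup>2"
proof -
  have inj: "inj_on (\<lambda>m. m * K) {0..M - 1}" using K by (auto simp: inj_on_def)
  then have "card ((\<lambda>m. m * K) ` {0..M - 1}) = nat M" by (simp add: card_image)
  then show ?thesis
    using M by (simp add: frame_term_def sum.reindex[OF inj] norm_divide cis_conv_exp mult_ac)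
qed

lemma almost_parseval_frame_ineq_arith_progression:
  fixes N M K \<alpha> :: int
  assumes M: "M > 0" and K: "K > 0" and N: "N = M * K + \<alpha>" and \<alpha>: "0 \<le> \<alpha>"
    and e: "e = 2 * pi * of_int \<alpha> * sqrt (of_int M) / of_int K" and e1: "e < 1"
  shows "almost_parseval_frame_ineq e N ((\<lambda>m. m * K) ` {0..M - 1}) {0..M - 1}"
  unfolding almost_parseval_frame_ineq_def
proof (intro allI)
  fix w :: "int \<Rightarrow> complex"
  let ?I = "{0..M - 1}"
  let ?B = "(\<lambda>m. m * K) ` ?I"
  define x where "x m = w (m * K)" for m
  define W where "W = L2_set (\<lambda>m. cmod (x m)) ?I"
  define E where "E m l = cis (- (2 * pi * of_int m * of_int K * of_int l / of_int N))" for m l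
  \<comment> \<open>\<open>f\<close> comes from the actual frame and \<open>g\<close> from the
    Fourier model. Only moduli are kept, since the frame bounds see nothing else.\<close>
  define f where "f l = cmod (\<Sum>m\<in>?I. x m * E m l) / sqrt (of_int M)" for l
  define g where "g l = cmod (\<Sum>m\<in>?I. x m * dft_char M m l) / sqrt (of_int M)" for l
  have Npos: "N > 0" using M K N \<alpha> by (simp add: add_pos_nonneg)
  have W0: "W \<ge> 0" by (simp add: W_def L2_set_nonneg)
  have W2: "(\<Sum>b\<in>?B. (cmod (w b))\<^sup>2) = W\<^sup>2"
  proof -
    have "inj_on (\<lambda>m. m * K) ?I" using K by (auto simp: inj_on_def)
    then show ?thesis by (simp add: sum.reindex W_def L2_set_def x_def sum_nonneg)
  qed
  have gW: "L2_set g ?I = W"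
    using M dft_Parseval[OF M, of x]
    by (simp add: L2_set_def W_def g_def power_divide flip: sum_divide_distrib)
  have phase: "cmod (E m l - dft_char M m l) \<le> 2 * pi * of_int \<alpha> / of_int K"
    if m: "m \<in> ?I" and l: "l \<in> ?I" for m l
  proof -
    let ?s = "2 * pi * of_int m * of_int K * of_int l / of_int N"
    let ?t = "2 * pi * of_int m * of_int l / of_int M"
    have "cmod (E m l - dft_char M m l) \<le> \<bar>- ?s - - ?t\<bar>"
      unfolding E_def dft_char_def by (rule norm_cis_diff_le)
    also have "- ?s - - ?t = 2 * pi * of_int \<alpha> * (of_int m * of_int l) / (of_int M * of_int N)"
    proof -
      have "real_of_int N = of_int M * of_int K + of_int \<alpha>" by (simp add: N)
      then have "?t - ?s = 2 * pi * of_int m * of_int l * (of_int N - of_int M * of_int K) / (of_int M * of_int N)"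
        using M Npos by (simp add: field_simps)
      then show ?thesis by (simp add: N)
    qed
    also have "\<bar>\<dots>\<bar> = 2 * pi * of_int \<alpha> * (of_int m * of_int l) / (of_int M * of_int N)"
      using m l \<alpha> M Npos by simp
    also have "\<dots> \<le> 2 * pi * of_int \<alpha> * (of_int M * of_int M) / (of_int M * of_int N)"
      using m l \<alpha> M Npos by (intro divide_right_mono mult_left_mono mult_mono) auto
    also have "\<dots> = 2 * pi * of_int \<alpha> * (of_int M / of_int N)"
      using M by simp
    also have "\<dots> \<le> 2 * pi * of_int \<alpha> * (1 / of_int K)"
    proof (rule mult_left_mono)
      \<comment> \<open>The sign of \<alpha> matters here: it gives
        \<open>M / N \<le> 1 / K\<close>.\<close>
      have "real_of_int (M * K) \<le> of_int N" using \<alpha> by (simp only: of_int_le_iff N)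
      then show "real_of_int M / of_int N \<le> 1 / of_int K"
        using K Npos by (simp add: field_simps)
    qed (use \<alpha> in simp)
    finally show ?thesis by simp
  qed
  have fg: "\<bar>f l - g l\<bar> \<le> 2 * pi * of_int \<alpha> / of_int K * W" if l: "l \<in> ?I" for l
  proof -
    have "\<bar>f l - g l\<bar>
        = \<bar>cmod (\<Sum>m\<in>?I. x m * E m l) - cmod (\<Sum>m\<in>?I. x m * dft_char M m l)\<bar> / sqrt (of_int M)"
      using M by (simp add: f_def g_def abs_divide flip: diff_divide_distrib)
    also have "\<dots> \<le> cmod (\<Sum>m\<in>?I. x m * (E m l - dft_char M m l)) / sqrt (of_int M)"
      using M norm_triangle_ineq3[of "\<Sum>m\<in>?I. x m * E m l" "\<Sum>m\<in>?I. x m * dft_char M m l"]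
      by (intro divide_right_mono) (simp_all add: right_diff_distrib sum_subtractf)
    also have "\<dots> \<le> (\<Sum>m\<in>?I. cmod (x m) * (2 * pi * of_int \<alpha> / of_int K)) / sqrt (of_int M)"
      using M l
      by (intro divide_right_mono sum_norm_le) (simp_all only: norm_mult mult_left_mono phase norm_ge_zero real_sqrt_ge_0_iff of_int_0_le_iff less_imp_le)
    also have "\<dots> = 2 * pi * of_int \<alpha> / of_int K * ((\<Sum>m\<in>?I. cmod (x m)) / sqrt (of_int M))"
      unfolding sum_distrib_right[symmetric] by (simp add: mult_ac)
    also have "\<dots> \<le> 2 * pi * of_int \<alpha> / of_int K * W"
    proof (rule mult_left_mono)
      \<comment> \<open>Cauchy-Schwarz against the constant 1, whose norm \<open>sqrt M\<close>
        cancels the normalising factor.\<close>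
      have "(\<Sum>m\<in>?I. \<bar>cmod (x m)\<bar> * \<bar>1\<bar>) \<le> W * L2_set (\<lambda>_. 1) ?I"
        unfolding W_def by (rule L2_set_mult_ineq)
      then show "(\<Sum>m\<in>?I. cmod (x m)) / sqrt (of_int M) \<le> W"
        using M by (simp add: L2_set_def divide_le_eq)
    qed (use \<alpha> K in simp)
    finally show ?thesis .
  qed
  have "\<bar>L2_set f ?I - L2_set g ?I\<bar> \<le> L2_set (\<lambda>l. f l - g l) ?I"
    by (rule L2_set_abs_diff_le)
  \<comment> \<open>Monotonicity of \<open>L2_set\<close> requires nonnegative entries.\<close>
  also have "\<dots> = L2_set (\<lambda>l. \<bar>f l - g l\<bar>) ?I"
    by (simp add: L2_set_def)
  also have "\<dots> \<le> L2_set (\<lambda>_. 2 * pi * of_int \<alpha> / of_int K * W) ?I"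
    by (intro L2_set_mono fg) auto
  \<comment> \<open>The norm of a constant over the \<open>M\<close> values of \<open>l\<close>
    contributes the \<open>sqrt M\<close> in \<open>e\<close>.\<close>
  also have "\<dots> = e * W"
    using M K \<alpha> W0 by (simp add: L2_set_def e real_sqrt_mult)
  finally have fW: "\<bar>L2_set f ?I - W\<bar> \<le> e * W" by (simp only: gW)
  have fsq: "(\<Sum>\<^sub>\<infinity>l\<in>?I. frame_term N ?B w l) = (L2_set f ?I)\<^sup>2"
    using frame_term_arith_progression[OF M K, of N w]
    by (simp add: L2_set_def sum_nonneg f_def E_def x_def)
  \<comment> \<open>Squaring is monotone only on nonnegative reals; \<open>e < 1\<close> makes the
    left base nonnegative.\<close>
  have "((1 - e) * W)\<^sup>2 \<le> (L2_set f ?I)\<^sup>2"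
    using fW e1 W0 by (intro power_mono) (simp_all add: algebra_simps abs_le_iff mult_left_le)
  moreover have "(L2_set f ?I)\<^sup>2 \<le> ((1 + e) * W)\<^sup>2"
    using fW by (intro power_mono) (simp_all add: algebra_simps abs_le_iff L2_set_nonneg)
  ultimately show "frame_term N ?B w summable_on ?I \<and>
      (1 - e)\<^sup>2 * (\<Sum>b\<in>?B. (cmod (w b))\<^sup>2) \<le> (\<Sum>\<^sub>\<infinity>l\<in>?I. frame_term N ?B w l) \<and>
      (\<Sum>\<^sub>\<infinity>l\<in>?I. frame_term N ?B w l) \<le> (1 + e)\<^sup>2 * (\<Sum>b\<in>?B. (cmod (w b))\<^sup>2)"
    unfolding W2 fsq power_mult_distrib by simp
qed

theorem theorem1p2:
  fixes N M K \<alpha> :: "nat \<Rightarrow> int" and \<epsilon> :: "nat \<Rightarrow> real" and B L :: "nat \<Rightarrow> int set"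
  assumes "\<And>j. j \<ge> 1 \<Longrightarrow> N j \<ge> 2"
    and "\<And>j. j \<ge> 1 \<Longrightarrow> M j > 0"
    and "\<And>j. j \<ge> 1 \<Longrightarrow> K j \<noteq> 0"
    and "\<And>j. j \<ge> 1 \<Longrightarrow> N j = M j * K j + \<alpha> j"
    and "\<And>j. j \<ge> 1 \<Longrightarrow> 0 \<le> \<alpha> j \<and> \<alpha> j < M j"
    and "summable (\<lambda>j. real_of_int (\<alpha> (Suc j)) * sqrt (of_int (M (Suc j))) / of_int (K (Suc j)))"
    and "\<And>j. j \<ge> 1 \<Longrightarrow> B j = (\<lambda>m. m * K j) ` {0..M j - 1}"
    and "\<And>j. j \<ge> 1 \<Longrightarrow> L j = {0..M j - 1}"
    and "\<And>j. j \<ge> 1 \<Longrightarrow> \<epsilon> j = 2 * pi * of_int (\<alpha> j) * sqrt (of_int (M j)) / of_int (K j)"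
    and "\<And>j. j \<ge> 1 \<Longrightarrow> \<epsilon> j < 1"
  shows "almost_parseval_frame_tower \<epsilon> N B \<and> is_pre_spectrum \<epsilon> N B L"
proof -
  note N2 = assms(1) and M = assms(2) and K0 = assms(3) and N = assms(4) and \<alpha> = assms(5)
    and sm = assms(6) and B = assms(7) and L = assms(8) and e = assms(9) and e1 = assms(10)
  \<comment> \<open>A negative \<open>K j\<close> would give
    \<open>N j \<le> \<alpha> j - M j < 0\<close>.\<close>
  have K: "K j > 0" if j: "j \<ge> 1" for j
  proof (rule ccontr)
    assume "\<not> K j > 0"
    then have "M j * K j \<le> M j * (- 1)"
      using M[OF j] K0[OF j] by (intro mult_left_mono) auto
    then show False using N2[OF j] N[OF j] \<alpha>[OF j] by linarith
  qed
  have e0: "0 \<le> \<epsilon> j" if j: "j \<ge> 1" for j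
    using \<alpha>[OF j] K[OF j] M[OF j] by (simp add: e[OF j])
  have "summable (\<lambda>j. 2 * pi * (real_of_int (\<alpha> (Suc j)) * sqrt (of_int (M (Suc j))) / of_int (K (Suc j))))"
    by (rule summable_mult[OF sm])
  then have se: "summable (\<lambda>j. \<epsilon> (Suc j))"
    by (simp add: e mult_ac)
  have BN: "B j \<subseteq> {0..N j - 1} \<and> 0 \<in> B j" if j: "j \<ge> 1" for j
  proof -
    have "m * K j \<in> {0..N j - 1}" if m: "m \<in> {0..M j - 1}" for m
    proof -
      \<comment> \<open>The largest element is
        \<open>(M j - 1) * K j = N j - \<alpha> j - K j\<close>, at most \<open>N j - 1\<close>
        because \<open>K j \<ge> 1\<close>.\<close>
      have "m * K j \<le> (M j - 1) * K j"
        using m K[OF j] by (intro mult_right_mono) auto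
      then show ?thesis
        using m K[OF j] \<alpha>[OF j] by (simp add: N[OF j] algebra_simps)
    qed
    then show ?thesis using M[OF j] by (auto simp: B[OF j] intro!: image_eqI[of _ _ 0])
  qed
  have spec: "0 \<in> L j \<and> almost_parseval_frame_ineq (\<epsilon> j) (N j) (B j) (L j)" if j: "j \<ge> 1" for j
    unfolding B[OF j] L[OF j]
    using almost_parseval_frame_ineq_arith_progression[OF M[OF j] K[OF j] N[OF j] _ e[OF j] e1[OF j]]
      \<alpha>[OF j] M[OF j] by auto
  have "\<exists>L. 0 \<in> L \<and> almost_parseval_frame_ineq (\<epsilon> j) (N j) (B j) L" if j: "j \<ge> 1" for j
    using spec[OF j] by blast
  then show ?thesis
    unfolding almost_parseval_frame_tower_def is_pre_spectrum_def
    using e0 e1 se N2 BN spec by (intro conjI allI impI) simp_all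
qed

end
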